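(* Let $r\ge1$, $1\le k\le r$, let $\mathcal F$ be the set of front faces of $[0,1]^r$, and let $c$ be a copula of order $k$ on $[0,1]^r$. Let $a\colon\mathcal F\to(0,\infty)$ and $b\colon\mathcal F\to[0,\infty)$ be maps such that $b=\operatorname{tdeg}_c$ and such that $a$ is an accumulation point, as $s\to0$, of the maps $\tilde a(\cdot,s)\colon\mathcal F\to[0,\infty)$ defined for $s\in(0,1]$ by $$c_F\bigl(s[0,1]^{\dim F}\bigr)=\tilde a(F,s)\,s^{\operatorname{tdeg}_c(F)}.$$ Then: (i) $b$ is non-decreasing, i.e. $b(F')\ge b(F)$ for all $F,F'\in\mathcal F$ with $F'\supset F$; (ii) $(a(F),b(F))=(1,\dim F)$ for each $F\in\mathcal F$ with $\dim F\le k$; (iii) if $b$ is eventually constant at $F\in\mathcal F$, then $\sum_{F'\in\mathcal F,\,F'\supset F}(-1)^{\dim F'-\dim F}a(F')\ge0$.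
   Context: A front face of $[0,1]^r$ is a face containing the origin, i.e. a set $F(\nu)=\{u\in[0,1]^r:u_i=0\text{ if }\nu_i=0\}$, $\nu\in\{0,1\}^r$; $\dim F(\nu)=\sum_i\nu_i$; each front face $F$ is identified with $[0,1]^{\dim F}$. A copula of order $k$ is a Borel probability measure on $[0,1]^r$ whose push-forward to each front face of dimension $k$ (under the coordinate projection) is the uniform probability measure. $c_F$ denotes the push-forward of $c$ under the coordinate projection $[0,1]^r\to F$. For $F\in\mathcal F$, $$\operatorname{tdeg}_c(F)=\inf\Big\{\tau\in\mathbb R:\liminf_{s\to0}\frac{c_F(s[0,1]^{\dim F})}{s^\tau}=\infty\Big\}.$$ $a$ is an accumulation point of $\tilde a(\cdot,s)$ as $s\to0$ if there is a sequence $s_m\to0$ in $(0,1]$ with $\tilde a(F,s_m)\to a(F)$ for all $F\in\mathcal F$. A map $b$ on $\mathcal F$ is eventually constant at $F$ if $b(F)=b(F')$ for each $F'\in\mathcal F$ with $F\subset F'$, $F\neq F'$. *)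

theory Defs
  imports "HOL-Probability.Probability"
begin

text \<open>
  Points of \<open>[0,1]\<^sup>J\<close> are the extensional functions on the finite index set \<open>J\<close>;
  the coordinates of \<open>[0,1]\<^sup>r\<close> are indexed by \<open>{..<r}\<close>.
  The measure \<open>unif J\<close> is the product of the Lebesgue measures on \<open>[0,1]\<close>, so its
  \<open>\<sigma>\<close>-algebra is the Borel \<open>\<sigma>\<close>-algebra of \<open>[0,1]\<^sup>J\<close>.
\<close>

definition cube :: "nat set \<Rightarrow> real \<Rightarrow> (nat \<Rightarrow> real) set" where
  "cube J s = (\<Pi>\<^sub>E i\<in>J. {0..s})"

definition unif :: "nat set \<Rightarrow> (nat \<Rightarrow> real) measure" where
  "unif J = (\<Pi>\<^sub>M i\<in>J. restrict_space lborel {0..1})"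

definition front_face :: "nat \<Rightarrow> (nat \<Rightarrow> nat) \<Rightarrow> (nat \<Rightarrow> real) set" where
  "front_face r \<nu> = {u \<in> cube {..<r} 1. \<forall>i<r. \<nu> i = 0 \<longrightarrow> u i = 0}"

definition front_faces :: "nat \<Rightarrow> (nat \<Rightarrow> real) set set" where
  "front_faces r = front_face r ` ({..<r} \<rightarrow>\<^sub>E {0, 1})"

text \<open>
  A face \<open>F\<close> is identified with \<open>[0,1]\<^sup>J\<close>, where \<open>J = coords r F\<close> is the set of
  coordinates that do not vanish identically on \<open>F\<close>, that is, \<open>J = {i. \<nu> i = 1}\<close> if
  \<open>F = front_face r \<nu>\<close>; see \<open>coords_front_face\<close> and \<open>face_dim_front_face\<close>.
\<close>

definition coords :: "nat \<Rightarrow> (nat \<Rightarrow> real) set \<Rightarrow> nat set" where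
  "coords r F = {i. i < r \<and> (\<exists>u\<in>F. u i \<noteq> 0)}"

definition face_dim :: "nat \<Rightarrow> (nat \<Rightarrow> real) set \<Rightarrow> nat" where
  "face_dim r F = card (coords r F)"

definition face_marginal ::
  "nat \<Rightarrow> (nat \<Rightarrow> real) measure \<Rightarrow> (nat \<Rightarrow> real) set \<Rightarrow> (nat \<Rightarrow> real) measure" where
  "face_marginal r c F = distr c (unif (coords r F)) (\<lambda>u. restrict u (coords r F))"

definition copula_of_order :: "nat \<Rightarrow> nat \<Rightarrow> (nat \<Rightarrow> real) measure \<Rightarrow> bool" where
  "copula_of_order r k c \<longleftrightarrow>
     prob_space c \<and> sets c = sets (unif {..<r}) \<and>
     (\<forall>F\<in>front_faces r. face_dim r F = k \<longrightarrow> face_marginal r c F = unif (coords r F))"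

definition corner_mass :: "nat \<Rightarrow> (nat \<Rightarrow> real) measure \<Rightarrow> (nat \<Rightarrow> real) set \<Rightarrow> real \<Rightarrow> real" where
  "corner_mass r c F s = measure (face_marginal r c F) (cube (coords r F) s)"

text \<open>The infimum is taken in the extended reals; it is \<open>\<infinity>\<close> if no \<open>\<tau>\<close> qualifies.\<close>

definition tdeg :: "nat \<Rightarrow> (nat \<Rightarrow> real) measure \<Rightarrow> (nat \<Rightarrow> real) set \<Rightarrow> ereal" where
  "tdeg r c F =
     Inf (ereal ` {\<tau>. Liminf (at_right 0) (\<lambda>s. ereal (corner_mass r c F s / s powr \<tau>)) = \<infinity>})"

text \<open>Meaningful only where \<open>tdeg r c F\<close> is finite.\<close>

definition a_tilde :: "nat \<Rightarrow> (nat \<Rightarrow> real) measure \<Rightarrow> (nat \<Rightarrow> real) set \<Rightarrow> real \<Rightarrow> real" where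
  "a_tilde r c F s = corner_mass r c F s / s powr real_of_ereal (tdeg r c F)"

definition accumulation_point_at_0 ::
  "'f set \<Rightarrow> ('f \<Rightarrow> real \<Rightarrow> real) \<Rightarrow> ('f \<Rightarrow> real) \<Rightarrow> bool" where
  "accumulation_point_at_0 \<F> h a \<longleftrightarrow>
     (\<exists>s::nat \<Rightarrow> real. (\<forall>m. s m \<in> {0<..1}) \<and> s \<longlonglongrightarrow> 0 \<and>
        (\<forall>F\<in>\<F>. (\<lambda>m. h F (s m)) \<longlonglongrightarrow> a F))"

definition eventually_constant_at :: "'p set set \<Rightarrow> ('p set \<Rightarrow> real) \<Rightarrow> 'p set \<Rightarrow> bool" where
  "eventually_constant_at \<F> b F \<longleftrightarrow> (\<forall>F'\<in>\<F>. F \<subset> F' \<longrightarrow> b F = b F')"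

lemma coords_front_face:
  assumes "\<nu> \<in> {..<r} \<rightarrow>\<^sub>E {0, 1}"
  shows "coords r (front_face r \<nu>) = {i. i < r \<and> \<nu> i = 1}"
proof -
  have nu: "\<nu> i = 0 \<or> \<nu> i = 1" if "i < r" for i
    using assms that by (auto simp: PiE_def Pi_def)
  have "(\<lambda>i\<in>{..<r}. real (\<nu> i)) \<in> front_face r \<nu>"
    using nu by (force simp: front_face_def cube_def)
  then have "\<exists>u\<in>front_face r \<nu>. u i \<noteq> 0" if "i < r" "\<nu> i = 1" for i
    using that by (intro bexI[of _ "\<lambda>i\<in>{..<r}. real (\<nu> i)"]) auto
  moreover have "\<nu> i = 1" if "i < r" "u \<in> front_face r \<nu>" "u i \<noteq> 0" for i u
    using that nu[of i] by (auto simp: front_face_def)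
  ultimately show ?thesis
    unfolding coords_def by blast
qed

lemma face_dim_front_face:
  assumes "\<nu> \<in> {..<r} \<rightarrow>\<^sub>E {0, 1}"
  shows "face_dim r (front_face r \<nu>) = (\<Sum>i<r. \<nu> i)"
proof -
  have "(\<Sum>i<r. \<nu> i) = (\<Sum>i<r. if \<nu> i = 1 then 1 else 0)"
    using assms by (intro sum.cong) (auto simp: PiE_def Pi_def)
  also have "\<dots> = card {i. i < r \<and> \<nu> i = 1}"
    by (simp add: sum.If_cases Int_def)
  finally show ?thesis
    by (simp add: face_dim_def coords_front_face[OF assms])
qed

lemma cube_scaled:
  assumes "0 < s"
  shows "cube J s = (\<lambda>u. \<lambda>i\<in>J. s * u i) ` cube J 1"
proof (intro equalityI subsetI)
  fix v assume v: "v \<in> cube J s"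
  then have "v = (\<lambda>i\<in>J. s * (\<lambda>i\<in>J. v i / s) i)"
    using assms by (auto simp: cube_def fun_eq_iff PiE_def extensional_def)
  moreover have "(\<lambda>i\<in>J. v i / s) \<in> cube J 1"
    using v assms by (auto simp: cube_def PiE_def Pi_def)
  ultimately show "v \<in> (\<lambda>u. \<lambda>i\<in>J. s * u i) ` cube J 1"
    by blast
next
  fix v assume "v \<in> (\<lambda>u. \<lambda>i\<in>J. s * u i) ` cube J 1"
  then show "v \<in> cube J s"
    using assms by (auto simp: cube_def PiE_def Pi_def mult_left_le)
qed

lemma space_unif: "space (unif J) = cube J 1"
  by (simp add: unif_def cube_def space_PiM space_restrict_space)

end

theory Submission
  imports Defs
begin

text \<open>
  Up to scaling by \<open>s\<close> to the power \<open>tdeg\<close>, the value \<open>a_tilde r c F s\<close> is the probability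
  that all coordinates in \<open>coords r F\<close> are at most \<open>s\<close>. This probability decreases in \<open>F\<close>,
  which gives (i), and it equals \<open>s\<close> to the power \<open>face_dim r F\<close> if \<open>face_dim r F \<le> k\<close>,
  which gives (ii). By inclusion-exclusion, the alternating sum of these probabilities over
  the faces containing \<open>F\<close> is the probability that exactly the coordinates in \<open>coords r F\<close>
  are at most \<open>s\<close>, hence is nonnegative; if \<open>b\<close> is eventually constant at \<open>F\<close>, all terms
  have the same scaling exponent, so (iii) follows in the limit.
\<close>

section \<open>Front faces, their coordinate sets, and inclusion-exclusion\<close>

lemma coords_mono: "F \<subseteq> F' \<Longrightarrow> coords r F \<subseteq> coords r F'"
  by (auto simp: coords_def)

lemma coords_subset: "coords r F \<subseteq> {..<r}"
  by (auto simp: coords_def)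

lemma finite_coords [simp]: "finite (coords r F)"
  by (rule finite_subset[OF coords_subset]) simp

text \<open>The values of \<open>\<nu>\<close> on \<open>{..<r}\<close> are 0 or 1, so
  \<open>coords r F\<close> determines \<open>\<nu>\<close> there, and hence \<open>F\<close>. This
  is what lets inclusion of faces be read off from inclusion of coordinate sets.\<close>

lemma front_face_eq_coords:
  assumes "F \<in> front_faces r"
  shows "F = {u \<in> cube {..<r} 1. \<forall>i<r. i \<notin> coords r F \<longrightarrow> u i = 0}"
proof -
  obtain \<nu> where nu: "\<nu> \<in> {..<r} \<rightarrow>\<^sub>E {0, 1}" and F: "F = front_face r \<nu>"
    using assms by (auto simp: front_faces_def)
  have "\<nu> i = 0 \<longleftrightarrow> i \<notin> coords r F" if "i < r" for i
  proof -
    have "\<nu> i = 0 \<or> \<nu> i = 1"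
      using nu that by (auto simp: PiE_def Pi_def)
    then show ?thesis
      using that by (auto simp: F coords_front_face[OF nu])
  qed
  then show ?thesis
    unfolding F front_face_def[of r \<nu>] by auto
qed

lemma front_face_subset_iff:
  assumes "F \<in> front_faces r" "F' \<in> front_faces r"
  shows "F \<subseteq> F' \<longleftrightarrow> coords r F \<subseteq> coords r F'"
proof
  assume "coords r F \<subseteq> coords r F'"
  then show "F \<subseteq> F'"
    by (subst front_face_eq_coords[OF assms(1)], subst front_face_eq_coords[OF assms(2)]) auto
qed (rule coords_mono)

lemma bij_betw_coords: "bij_betw (coords r) (front_faces r) (Pow {..<r})"
proof (rule bij_betwI')
  fix F F' assume "F \<in> front_faces r" "F' \<in> front_faces r"
  then show "coords r F = coords r F' \<longleftrightarrow> F = F'"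
    using front_face_subset_iff by blast
next
  fix J assume J: "J \<in> Pow {..<r}"
  \<comment> \<open>The indicator of \<open>J\<close>, cut off outside \<open>{..<r}\<close> so that
    it is extensional.\<close>
  define \<nu> :: "nat \<Rightarrow> nat" where "\<nu> = (\<lambda>i\<in>{..<r}. if i \<in> J then 1 else 0)"
  have nu: "\<nu> \<in> {..<r} \<rightarrow>\<^sub>E {0, 1}"
    by (auto simp: \<nu>_def)
  have "J = coords r (front_face r \<nu>)"
    unfolding coords_front_face[OF nu] using J by (auto simp: \<nu>_def split: if_splits)
  then show "\<exists>F\<in>front_faces r. J = coords r F"
    using nu by (auto simp: front_faces_def)
qed (use coords_subset in auto)

text \<open>Reindexes sums over the faces above \<open>F\<close> by the sets of added coordinates,
  the form in which inclusion-exclusion applies.\<close>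

lemma bij_betw_coords_above:
  assumes "F \<in> front_faces r"
  shows "bij_betw (\<lambda>F'. coords r F' - coords r F) {F' \<in> front_faces r. F \<subseteq> F'}
    (Pow ({..<r} - coords r F))"
proof (rule bij_betwI')
  fix F1 F2 assume "F1 \<in> {F' \<in> front_faces r. F \<subseteq> F'}" "F2 \<in> {F' \<in> front_faces r. F \<subseteq> F'}"
  then have "coords r F1 = coords r F2 \<longleftrightarrow> F1 = F2" "coords r F \<subseteq> coords r F1"
      "coords r F \<subseteq> coords r F2"
    using coords_mono front_face_subset_iff[of F1 r F2] front_face_subset_iff[of F2 r F1] by auto
  then show "coords r F1 - coords r F = coords r F2 - coords r F \<longleftrightarrow> F1 = F2"
    by blast
next
  fix F' assume "F' \<in> {F' \<in> front_faces r. F \<subseteq> F'}"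
  then show "coords r F' - coords r F \<in> Pow ({..<r} - coords r F)"
    using coords_subset by blast
next
  fix B assume B: "B \<in> Pow ({..<r} - coords r F)"
  then have "coords r F \<union> B \<in> Pow {..<r}"
    using coords_subset by blast
  then obtain F' where F': "F' \<in> front_faces r" "coords r F \<union> B = coords r F'"
    using bij_betw_coords[of r] unfolding bij_betw_def by (metis imageE)
  then have "F \<subseteq> F'"
    using front_face_subset_iff[OF assms F'(1)] by blast
  moreover have "B = coords r F' - coords r F"
    using F'(2) B by blast
  ultimately show "\<exists>F'\<in>{F' \<in> front_faces r. F \<subseteq> F'}. B = coords r F' - coords r F"
    using F'(1) by blast
qed

text \<open>Expansion of the product over \<open>A\<close> of 1 minus the indicator of
  \<open>S i\<close>, integrated over \<open>E\<close>. In the induction, the subsets of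
  \<open>insert j A\<close> are split by whether they contain \<open>j\<close>; those that do lead
  to the same sum with \<open>E \<inter> S j\<close> in place of \<open>E\<close>, so
  \<open>E\<close> has to stay arbitrary.\<close>

lemma (in finite_measure) inclusion_exclusion:
  assumes "finite A" "E \<in> sets M" "\<And>i. i \<in> A \<Longrightarrow> S i \<in> sets M"
  shows "(\<Sum>B\<in>Pow A. (-1) ^ card B * measure M {x \<in> E. \<forall>i\<in>B. x \<in> S i}) =
    measure M {x \<in> E. \<forall>i\<in>A. x \<notin> S i}"
  using assms
proof (induction A arbitrary: E rule: finite_induct)
  case (insert j A)
  have disj: "Pow A \<inter> insert j ` Pow A = {}"
    using insert.hyps by auto
  have inj: "inj_on (insert j) (Pow A)"
    using insert.hyps by (auto simp: inj_on_def)
  have ES: "E \<inter> S j \<in> sets M"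
    using insert.prems by auto
  have meas: "{x \<in> E. \<forall>i\<in>A. x \<notin> S i} \<in> sets M"
  proof -
    have "{x \<in> E. \<forall>i\<in>A. x \<notin> S i} = E - (\<Union>i\<in>A. S i)"
      by auto
    then show ?thesis
      using insert.hyps(1) insert.prems by (simp add: sets.Diff sets.finite_UN)
  qed
  have card: "card (insert j B) = Suc (card B)" if "B \<in> Pow A" for B
    using that insert.hyps by (meson PowD card_insert_disjoint finite_subset subsetD)
  have "(\<Sum>B\<in>Pow (insert j A). (-1) ^ card B * measure M {x \<in> E. \<forall>i\<in>B. x \<in> S i}) =
    (\<Sum>B\<in>Pow A. (-1) ^ card B * measure M {x \<in> E. \<forall>i\<in>B. x \<in> S i}) +
    (\<Sum>B\<in>Pow A. (-1) ^ card (insert j B) * measure M {x \<in> E. \<forall>i\<in>insert j B. x \<in> S i})"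
    using insert.hyps(1) disj
    by (simp add: Pow_insert sum.union_disjoint sum.reindex[OF inj])
  \<comment> \<open>The extra element \<open>j\<close> contributes one sign, and the condition
    \<open>x \<in> S j\<close> is absorbed into \<open>E\<close>.\<close>
  also have "(\<Sum>B\<in>Pow A. (-1) ^ card (insert j B) * measure M {x \<in> E. \<forall>i\<in>insert j B. x \<in> S i}) =
    - (\<Sum>B\<in>Pow A. (-1) ^ card B * measure M {x \<in> E \<inter> S j. \<forall>i\<in>B. x \<in> S i})"
    unfolding sum_negf[symmetric]
    by (intro sum.cong refl) (simp add: card conj_assoc)
  also have "(\<Sum>B\<in>Pow A. (-1) ^ card B * measure M {x \<in> E. \<forall>i\<in>B. x \<in> S i}) =
      measure M {x \<in> E. \<forall>i\<in>A. x \<notin> S i}"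
    using insert by simp
  also have "(\<Sum>B\<in>Pow A. (-1) ^ card B * measure M {x \<in> E \<inter> S j. \<forall>i\<in>B. x \<in> S i}) =
      measure M {x \<in> E \<inter> S j. \<forall>i\<in>A. x \<notin> S i}"
    by (rule insert.IH[OF ES]) (use insert.prems in auto)
  also have "{x \<in> E \<inter> S j. \<forall>i\<in>A. x \<notin> S i} = {x \<in> E. \<forall>i\<in>A. x \<notin> S i} \<inter> S j"
    by auto
  also have "measure M {x \<in> E. \<forall>i\<in>A. x \<notin> S i} + - measure M ({x \<in> E. \<forall>i\<in>A. x \<notin> S i} \<inter> S j) =
      measure M ({x \<in> E. \<forall>i\<in>A. x \<notin> S i} - S j)"
    using finite_measure_Diff'[OF meas, of "S j"] insert.prems by simp
  also have "{x \<in> E. \<forall>i\<in>A. x \<notin> S i} - S j = {x \<in> E. \<forall>i\<in>insert j A. x \<notin> S i}"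
    by auto
  finally show ?case .
qed simp

section \<open>Cubes and cylinders under product and image measures\<close>

lemma Icc_in_sets_unit_interval:
  assumes "s \<le> (1::real)"
  shows "{0..s} \<in> sets (restrict_space lborel {0..1})"
  using assms by (auto simp: sets_restrict_space_iff)

lemma cube_in_sets_unif:
  assumes "finite J" "s \<le> 1"
  shows "cube J s \<in> sets (unif J)"
  unfolding cube_def unif_def
  using assms by (intro sets_PiM_I_finite Icc_in_sets_unit_interval) auto

lemma measurable_restrict_unif:
  assumes "J \<subseteq> K"
  shows "(\<lambda>u. restrict u J) \<in> measurable (unif K) (unif J)"
  unfolding unif_def by (rule measurable_restrict_subset[OF assms])

lemma prob_space_restrict_unit_interval: "prob_space (restrict_space lborel {0..1::real})"
  by (intro prob_spaceI) (simp add: space_restrict_space emeasure_restrict_space)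

text \<open>As a box with sides \<open>s\<close> or 1, the cylinder is measurable and its uniform
  measure is a product of side lengths. Since \<open>s \<le> 1\<close>, the bound by
  \<open>s\<close> replaces the bound by 1 on \<open>J\<close>.\<close>

lemma cylinder_eq_PiE:
  assumes "J \<subseteq> K" "s \<le> 1"
  shows "{u \<in> cube K 1. \<forall>i\<in>J. u i \<le> s} = (\<Pi>\<^sub>E i\<in>K. {0..if i \<in> J then s else 1})"
proof -
  have "(\<forall>i\<in>K. 0 \<le> u i \<and> u i \<le> 1) \<and> (\<forall>i\<in>J. u i \<le> s) \<longleftrightarrow>
      (\<forall>i\<in>K. 0 \<le> u i \<and> u i \<le> (if i \<in> J then s else 1))" for u :: "nat \<Rightarrow> real"
    using assms by (smt (verit) subsetD)
  then have "u \<in> cube K 1 \<and> (\<forall>i\<in>J. u i \<le> s) \<longleftrightarrow>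
      u \<in> (\<Pi>\<^sub>E i\<in>K. {0..if i \<in> J then s else 1})" for u
    unfolding cube_def PiE_iff atLeastAtMost_iff by blast
  then show ?thesis
    by blast
qed

lemma measure_unif_cylinder:
  assumes "finite K" "J \<subseteq> K" "0 < s" "s \<le> 1"
  shows "measure (unif K) {u \<in> cube K 1. \<forall>i\<in>J. u i \<le> s} = s ^ card J"
proof -
  interpret I: prob_space "restrict_space lborel {0..1::real}"
    by (rule prob_space_restrict_unit_interval)
  interpret P: finite_product_prob_space "\<lambda>_. restrict_space lborel {0..1::real}" K
    by unfold_locales (rule assms(1))
  have m: "measure (restrict_space lborel {0..1}) {0..t} = t" if "0 \<le> t" "t \<le> 1" for t :: real
    using that by (simp add: measure_restrict_space)
  have "measure (unif K) {u \<in> cube K 1. \<forall>i\<in>J. u i \<le> s} =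
      (\<Prod>i\<in>K. measure (restrict_space lborel {0..1}) {0..if i \<in> J then s else 1})"
    unfolding cylinder_eq_PiE[OF assms(2,4)] unif_def
    using assms by (intro P.finite_measure_PiM_emb Icc_in_sets_unit_interval) auto
  also have "\<dots> = (\<Prod>i\<in>K. if i \<in> J then s else 1)"
    using assms by (intro prod.cong refl) (auto simp: m)
  also have "\<dots> = s ^ card J"
    using assms by (simp add: prod.If_cases Int_absorb1)
  finally show ?thesis .
qed

text \<open>The marginals of different faces live on different spaces. Pulled back to
  \<open>space c\<close>, their corner masses become probabilities of events in one space and can be
  compared and added.\<close>

lemma corner_mass_eq_measure:
  assumes "sets c = sets (unif {..<r})" "s \<le> 1"
  shows "corner_mass r c F s = measure c {u \<in> space c. \<forall>i\<in>coords r F. u i \<le> s}"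
proof -
  have space: "space c = cube {..<r} 1"
    using sets_eq_imp_space_eq[OF assms(1)] by (simp add: space_unif)
  have "(\<lambda>u. restrict u (coords r F)) \<in> measurable c (unif (coords r F))"
    using measurable_restrict_unif[OF coords_subset] measurable_cong_sets[OF assms(1) refl] by blast
  then have "corner_mass r c F s =
      measure c ((\<lambda>u. restrict u (coords r F)) -` cube (coords r F) s \<inter> space c)"
    unfolding corner_mass_def face_marginal_def
    by (rule measure_distr) (intro cube_in_sets_unif finite_coords assms)
  \<comment> \<open>The lower bounds \<open>0 \<le> u i\<close> hold because \<open>space c\<close>
    is the unit cube.\<close>
  also have "(\<lambda>u. restrict u (coords r F)) -` cube (coords r F) s \<inter> space c =
      {u \<in> space c. \<forall>i\<in>coords r F. u i \<le> s}"
    using coords_subset by (fastforce simp: space cube_def PiE_iff)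
  finally show ?thesis .
qed

section \<open>Corner events and the comparison of their masses between faces\<close>

lemma coordinate_le_in_sets:
  assumes "sets c = sets (unif {..<r})" "i < r"
  shows "{u \<in> space c. u i \<le> s} \<in> sets c"
proof -
  have "(\<lambda>u. u i) \<in> borel_measurable (unif {..<r})"
  proof -
    have "(\<lambda>u. u i) \<in> measurable (unif {..<r}) (restrict_space lborel {0..1})"
      unfolding unif_def using assms(2) by (intro measurable_component_singleton) simp
    moreover have "(\<lambda>x. x) \<in> measurable (restrict_space lborel {0..1}) (borel :: real measure)"
      by (intro measurable_restrict_space1) simp
    ultimately show ?thesis
      by (rule measurable_compose)
  qed
  then have [measurable]: "(\<lambda>u. u i) \<in> borel_measurable c"
    using measurable_cong_sets[OF assms(1) refl] by blast
  show ?thesis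
    by measurable
qed

lemma corner_event_in_sets:
  assumes "sets c = sets (unif {..<r})"
  shows "{u \<in> space c. \<forall>i\<in>coords r F. u i \<le> s} \<in> sets c"
  using coordinate_le_in_sets[OF assms] coords_subset[of r F]
  by (intro sets.sets_Collect_finite_All) auto

lemma corner_mass_antimono:
  assumes "sets c = sets (unif {..<r})" "finite_measure c" "F \<subseteq> F'" "s \<le> 1"
  shows "corner_mass r c F' s \<le> corner_mass r c F s"
proof -
  have "{u \<in> space c. \<forall>i\<in>coords r F. u i \<le> s} \<in> sets c"
    by (rule corner_event_in_sets[OF assms(1)])
  moreover have "{u \<in> space c. \<forall>i\<in>coords r F'. u i \<le> s} \<subseteq> {u \<in> space c. \<forall>i\<in>coords r F. u i \<le> s}"
    using coords_mono[OF assms(3)] by auto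
  ultimately show ?thesis
    using assms by (simp add: corner_mass_eq_measure finite_measure.finite_measure_mono)
qed

lemma eventually_at_right_0_Ioc: "eventually (\<lambda>s::real. 0 < s \<and> s \<le> 1) (at_right 0)"
  unfolding eventually_at_right_field by (intro exI[of _ 1]) auto

text \<open>Any exponent that makes the lower limit infinite for \<open>F'\<close> does so for
  \<open>F\<close>, whose corner mass is at least as large. Thus the infimum for \<open>F\<close>
  runs over a larger set; this also covers infinite values.\<close>

lemma tdeg_mono:
  assumes "sets c = sets (unif {..<r})" "finite_measure c" "F \<subseteq> F'"
  shows "tdeg r c F \<le> tdeg r c F'"
  unfolding tdeg_def
proof (intro Inf_superset_mono image_mono Collect_mono impI)
  fix \<tau>
  assume inf: "Liminf (at_right 0) (\<lambda>s. ereal (corner_mass r c F' s / s powr \<tau>)) = \<infinity>"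
  have "Liminf (at_right 0) (\<lambda>s. ereal (corner_mass r c F' s / s powr \<tau>)) \<le>
      Liminf (at_right 0) (\<lambda>s. ereal (corner_mass r c F s / s powr \<tau>))"
    by (intro Liminf_mono eventually_mono[OF eventually_at_right_0_Ioc])
      (simp add: divide_right_mono corner_mass_antimono assms)
  then show "Liminf (at_right 0) (\<lambda>s. ereal (corner_mass r c F s / s powr \<tau>)) = \<infinity>"
    using inf by simp
qed

lemma alternating_sum_corner_mass_nonneg:
  assumes "sets c = sets (unif {..<r})" "finite_measure c" "F \<in> front_faces r" "s \<le> 1"
  shows "0 \<le> (\<Sum>F'\<in>{F' \<in> front_faces r. F \<subseteq> F'}.
    (-1) ^ (face_dim r F' - face_dim r F) * corner_mass r c F' s)"
proof -
  define E where "E = {u \<in> space c. \<forall>i\<in>coords r F. u i \<le> s}"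
  define S where "S i = {u \<in> space c. u i \<le> s}" for i
  have "E \<in> sets c"
    unfolding E_def by (rule corner_event_in_sets[OF assms(1)])
  moreover have "S i \<in> sets c" if "i \<in> {..<r} - coords r F" for i
    unfolding S_def using that by (intro coordinate_le_in_sets[OF assms(1)]) auto
  \<comment> \<open>Inclusion-exclusion over the coordinates outside \<open>coords r F\<close> turns
    this sum into the measure of a single event.\<close>
  ultimately have "0 \<le> (\<Sum>B\<in>Pow ({..<r} - coords r F).
      (-1) ^ card B * measure c {x \<in> E. \<forall>i\<in>B. x \<in> S i})"
    by (subst finite_measure.inclusion_exclusion[OF assms(2)]) auto
  also have "\<dots> = (\<Sum>F'\<in>{F' \<in> front_faces r. F \<subseteq> F'}. (-1) ^ card (coords r F' - coords r F) *
      measure c {x \<in> E. \<forall>i\<in>coords r F' - coords r F. x \<in> S i})"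
    by (rule sum.reindex_bij_betw[OF bij_betw_coords_above[OF assms(3)], symmetric])
  also have "\<dots> = (\<Sum>F'\<in>{F' \<in> front_faces r. F \<subseteq> F'}.
      (-1) ^ (face_dim r F' - face_dim r F) * corner_mass r c F' s)"
  proof (intro sum.cong refl arg_cong2[where f = "(*)"])
    fix F' assume "F' \<in> {F' \<in> front_faces r. F \<subseteq> F'}"
    then have sub: "coords r F \<subseteq> coords r F'"
      using coords_mono by auto
    \<comment> \<open>The subtraction of natural numbers is not truncated, thanks to
      \<open>sub\<close>.\<close>
    show "(-1::real) ^ card (coords r F' - coords r F) = (-1) ^ (face_dim r F' - face_dim r F)"
      by (simp add: face_dim_def card_Diff_subset[OF _ sub])
    have "{x \<in> E. \<forall>i\<in>coords r F' - coords r F. x \<in> S i} =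
        {u \<in> space c. \<forall>i\<in>coords r F'. u i \<le> s}"
      using sub by (auto simp: E_def S_def)
    then show "measure c {x \<in> E. \<forall>i\<in>coords r F' - coords r F. x \<in> S i} = corner_mass r c F' s"
      by (simp add: corner_mass_eq_measure[OF assms(1,4)])
  qed
  finally show ?thesis .
qed

text \<open>The copula condition concerns faces of dimension exactly \<open>k\<close>. A face of
  smaller dimension is handled by enlarging its coordinate set to some \<open>K\<close> of size
  \<open>k\<close> and evaluating a cylinder under the uniform marginal on \<open>K\<close>.\<close>

lemma copula_corner_mass:
  assumes c: "copula_of_order r k c" and "k \<le> r" "face_dim r F \<le> k" "0 < s" "s \<le> 1"
  shows "corner_mass r c F s = s ^ face_dim r F"
proof -
  have sets: "sets c = sets (unif {..<r})"
    using c by (simp add: copula_of_order_def)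
  have space: "space c = cube {..<r} 1"
    using sets_eq_imp_space_eq[OF sets] by (simp add: space_unif)
  obtain K where K: "coords r F \<subseteq> K" "K \<subseteq> {..<r}" "card K = k"
    using exists_subset_between[of "coords r F" k "{..<r}"] assms coords_subset[of r F]
    by (auto simp: face_dim_def)
  obtain G where G: "G \<in> front_faces r" "coords r G = K"
    using bij_betw_coords[of r] K(2) unfolding bij_betw_def by (metis PowI imageE)
  have marginal: "distr c (unif K) (\<lambda>u. restrict u K) = unif K"
    using c G K(3) unfolding copula_of_order_def face_dim_def face_marginal_def by metis
  have fin: "finite K"
    using K(2) finite_subset by blast
  \<comment> \<open>Only the coordinates of \<open>F\<close> are bounded by \<open>s\<close>, the
    others in \<open>K\<close> being free, so that the preimage of \<open>C\<close> under
    restriction to \<open>K\<close> is the corner event of \<open>F\<close>.\<close>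
  define C where "C = {u \<in> cube K 1. \<forall>i\<in>coords r F. u i \<le> s}"
  have "C = (\<Pi>\<^sub>E i\<in>K. {0..if i \<in> coords r F then s else 1})"
    unfolding C_def by (rule cylinder_eq_PiE[OF K(1) assms(5)])
  then have C: "C \<in> sets (unif K)"
    unfolding unif_def using fin assms
    by (auto intro!: sets_PiM_I_finite Icc_in_sets_unit_interval)
  have "(\<lambda>u. restrict u K) \<in> measurable c (unif K)"
    using measurable_restrict_unif[OF K(2)] measurable_cong_sets[OF sets refl] by blast
  then have "measure (unif K) C = measure c ((\<lambda>u. restrict u K) -` C \<inter> space c)"
    using C by (subst marginal[symmetric], rule measure_distr)
  also have "(\<lambda>u. restrict u K) -` C \<inter> space c = {u \<in> space c. \<forall>i\<in>coords r F. u i \<le> s}"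
    using K by (auto simp: C_def space cube_def PiE_iff subset_iff extensional_def)
  also have "measure c \<dots> = corner_mass r c F s"
    using corner_mass_eq_measure[OF sets] assms by simp
  finally show ?thesis
    using measure_unif_cylinder[OF fin K(1)] assms by (simp add: C_def face_dim_def)
qed

section \<open>The tail degree of a pure power\<close>

lemma filterlim_powr_at_right_0_neg:
  assumes "p < 0"
  shows "filterlim (\<lambda>s::real. s powr p) at_top (at_right 0)"
proof -
  have "filterlim (\<lambda>x::real. x powr - p) at_top at_top"
    using assms by (intro real_powr_at_top) auto
  then have "filterlim (\<lambda>s::real. inverse s powr - p) at_top (at_right 0)"
    by (rule filterlim_compose[OF _ filterlim_inverse_at_top_right])
  then show ?thesis
    by (rule filterlim_cong[THEN iffD1, rotated -1])
      (auto simp: powr_minus inverse_powr eventually_at_right_field intro!: exI[of _ 1])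
qed

text \<open>Near 0 the quotient is \<open>s powr (real n - \<tau>)\<close>, which tends to infinity
  for \<open>\<tau>\<close> above \<open>n\<close> and is at most 1 otherwise. The admissible
  exponents thus form the open ray \<open>{real n<..}\<close>.\<close>

lemma tdeg_power:
  assumes "\<And>s. 0 < s \<Longrightarrow> s \<le> 1 \<Longrightarrow> corner_mass r c F s = s ^ n"
  shows "tdeg r c F = ereal (real n)"
proof -
  have "Liminf (at_right 0) (\<lambda>s. ereal (corner_mass r c F s / s powr \<tau>)) = \<infinity> \<longleftrightarrow> real n < \<tau>" for \<tau>
  proof -
    have "Liminf (at_right 0) (\<lambda>s. ereal (corner_mass r c F s / s powr \<tau>)) =
        Liminf (at_right 0) (\<lambda>s. ereal (s powr (real n - \<tau>)))"
      by (intro Liminf_eq eventually_mono[OF eventually_at_right_0_Ioc])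
        (simp add: assms powr_diff powr_realpow)
    moreover have "Liminf (at_right 0) (\<lambda>s. ereal (s powr (real n - \<tau>))) = \<infinity>" if "real n < \<tau>"
    proof (rule lim_imp_Liminf)
      show "((\<lambda>s. ereal (s powr (real n - \<tau>))) \<longlongrightarrow> \<infinity>) (at_right 0)"
        using that by (auto simp: tendsto_PInfty_eq_at_top intro!: filterlim_powr_at_right_0_neg)
    qed simp
    moreover have "Liminf (at_right 0) (\<lambda>s. ereal (s powr (real n - \<tau>))) \<le> 1" if "\<not> real n < \<tau>"
    proof -
      have "Liminf (at_right 0) (\<lambda>s. ereal (s powr (real n - \<tau>))) \<le> Liminf (at_right (0::real)) (\<lambda>_. 1)"
        using that
        by (intro Liminf_mono eventually_mono[OF eventually_at_right_0_Ioc]) (simp add: powr_le1)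
      then show ?thesis
        by (simp add: Liminf_const)
    qed
    ultimately show ?thesis
      by fastforce
  qed
  then have "tdeg r c F = Inf (ereal ` {real n<..})"
    by (simp add: tdeg_def greaterThan_def)
  also have "\<dots> = ereal (real n)"
  proof (rule antisym)
    show "Inf (ereal ` {real n<..}) \<le> ereal (real n)"
    \<comment> \<open>The infimum is not attained, so it is approached through the exponents
      \<open>real n + e\<close>.\<close>
    proof (rule ereal_le_epsilon2)
      fix e :: real assume "0 < e"
      then show "Inf (ereal ` {real n<..}) \<le> ereal (real n) + ereal e"
        by (intro Inf_lower) (auto intro!: image_eqI[of _ _ "real n + e"])
    qed
  qed (auto intro!: Inf_greatest)
  finally show ?thesis .
qed

section \<open>Passage to the limit along the sequence defining \<open>a\<close>\<close>

theorem mainTheorem3: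
  fixes r k :: nat
    and c :: "(nat \<Rightarrow> real) measure"
    and a b :: "(nat \<Rightarrow> real) set \<Rightarrow> real"
  assumes "1 \<le> r" and "1 \<le> k" and "k \<le> r"
    and "copula_of_order r k c"
    and "\<forall>F\<in>front_faces r. 0 < a F"
    and "\<forall>F\<in>front_faces r. 0 \<le> b F"
    and "\<forall>F\<in>front_faces r. ereal (b F) = tdeg r c F"
    and "accumulation_point_at_0 (front_faces r) (a_tilde r c) a"
  shows "(\<forall>F\<in>front_faces r. \<forall>F'\<in>front_faces r. F \<subseteq> F' \<longrightarrow> b F \<le> b F') \<and>
    (\<forall>F\<in>front_faces r. face_dim r F \<le> k \<longrightarrow> (a F, b F) = (1, real (face_dim r F))) \<and>
    (\<forall>F\<in>front_faces r. eventually_constant_at (front_faces r) b F \<longrightarrow>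
       0 \<le> (\<Sum>F'\<in>{F'\<in>front_faces r. F \<subseteq> F'}. (-1) ^ (face_dim r F' - face_dim r F) * a F'))"
proof -
  have sets: "sets c = sets (unif {..<r})" and "prob_space c"
    using assms(4) by (simp_all add: copula_of_order_def)
  then have fin: "finite_measure c"
    by (simp add: prob_space.finite_measure)
  have b: "tdeg r c F = ereal (b F)" if "F \<in> front_faces r" for F
    using assms(7) that by auto
  obtain s :: "nat \<Rightarrow> real" where s: "\<And>m. s m \<in> {0<..1}"
    and lim: "\<And>F. F \<in> front_faces r \<Longrightarrow> (\<lambda>m. a_tilde r c F (s m)) \<longlonglongrightarrow> a F"
    using assms(8) by (auto simp: accumulation_point_at_0_def)
  show ?thesis
  proof (intro conjI ballI impI)
    fix F F' assume "F \<in> front_faces r" "F' \<in> front_faces r" "F \<subseteq> F'"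
    then show "b F \<le> b F'"
      using tdeg_mono[OF sets fin, of F F'] by (simp add: b)
  next
    fix F assume F: "F \<in> front_faces r" "face_dim r F \<le> k"
    note mass = copula_corner_mass[OF assms(4,3) F(2)]
    have "tdeg r c F = ereal (real (face_dim r F))"
      by (intro tdeg_power mass)
    \<comment> \<open>The scaling exponent equals the exponent of the corner mass, so the two powers
      cancel at every \<open>s m\<close>.\<close>
    moreover from this have "a_tilde r c F (s m) = 1" for m
      using s[of m] by (simp add: a_tilde_def mass powr_realpow)
    then have "a F = 1"
      using lim[OF F(1)] by (simp add: LIMSEQ_const_iff)
    ultimately show "(a F, b F) = (1, real (face_dim r F))"
      using b[OF F(1)] by simp
  next
    fix F assume F: "F \<in> front_faces r" and const: "eventually_constant_at (front_faces r) b F"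
    \<comment> \<open>\<open>eventually_constant_at\<close> speaks of proper superfaces only; the
      sum also contains \<open>F\<close> itself.\<close>
    have b_eq: "b F' = b F" if "F' \<in> front_faces r" "F \<subseteq> F'" for F'
      using const that by (cases "F' = F") (auto simp: eventually_constant_at_def)
    \<comment> \<open>By \<open>b_eq\<close> all terms share the positive factor
      \<open>s m powr b F\<close>, so the sign of the alternating sum of corner masses carries
      over.\<close>
    have "(\<Sum>F'\<in>{F'\<in>front_faces r. F \<subseteq> F'}.
        (-1) ^ (face_dim r F' - face_dim r F) * a_tilde r c F' (s m)) =
      (\<Sum>F'\<in>{F'\<in>front_faces r. F \<subseteq> F'}.
        (-1) ^ (face_dim r F' - face_dim r F) * corner_mass r c F' (s m)) / s m powr b F" for m
      unfolding sum_divide_distrib by (intro sum.cong refl) (simp add: a_tilde_def b b_eq)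
    moreover have "0 \<le> (\<Sum>F'\<in>{F'\<in>front_faces r. F \<subseteq> F'}.
        (-1) ^ (face_dim r F' - face_dim r F) * corner_mass r c F' (s m))" for m
      using s[of m] by (intro alternating_sum_corner_mass_nonneg[OF sets fin F]) simp
    ultimately have "0 \<le> (\<Sum>F'\<in>{F'\<in>front_faces r. F \<subseteq> F'}.
        (-1) ^ (face_dim r F' - face_dim r F) * a_tilde r c F' (s m))" for m
      by simp
    moreover have "(\<lambda>m. \<Sum>F'\<in>{F'\<in>front_faces r. F \<subseteq> F'}.
        (-1) ^ (face_dim r F' - face_dim r F) * a_tilde r c F' (s m)) \<longlonglongrightarrow>
      (\<Sum>F'\<in>{F'\<in>front_faces r. F \<subseteq> F'}. (-1) ^ (face_dim r F' - face_dim r F) * a F')"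
      by (intro tendsto_sum tendsto_mult tendsto_const lim) simp
    ultimately show "0 \<le> (\<Sum>F'\<in>{F'\<in>front_faces r. F \<subseteq> F'}.
        (-1) ^ (face_dim r F' - face_dim r F) * a F')"
      by (intro LIMSEQ_le_const) auto
  qed
qed

end
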